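(* Let $r\in(-2,-1/2)\cap\mathbb Q$, $\rho\in(0,\sqrt2)$, and let $\eta_{r,\rho}:\mathbb R\to\mathcal S$ be the symmetrical configuration of the second kind with parameters $(r,\rho)$. Then $\eta_{r,\rho}$ is an isoparametric knot of the second class, with spectral ratio $r$. The trajectory $\mathcal E_{r,\rho}$ of $\eta_{r,\rho}$ is a positive torus knot of type $(p,q)$, where the positive integers $p$ and $q$ are, respectively, the numerator and the denominator (in lowest terms) of $\frac{2+r}{1-r}$. The trajectory $\mathcal E_{r,\rho}$ is contained in the standard Heisenberg cyclide $\mathcal T_\rho$ with parameter $\rho$.
   Context: $\mathbb C^{2,1}$ is $\mathbb C^3$ with the Hermitian form $\langle \mathbf z,\mathbf w\rangle={}^t\overline{\mathbf z}\,\mathbf h\,\mathbf w$, $\mathbf h=\begin{pmatrix}0&0&i\\0&1&0\\-i&0&0\end{pmatrix}$. $\mathcal N$ is the set of nonzero null vectors, $\mathcal S=\{[\mathbf z]\in\mathbb{CP}^2:\langle\mathbf z,\mathbf z\rangle=0\}$, with contact form $\zeta$ equal to the restriction to $T\mathcal S$ of $-i\langle\mathbf z,d\mathbf z\rangle/({}^t\overline{\mathbf z}\mathbf z)$. $G=\{A\in SL(3,\mathbb C):{}^t\bar A\mathbf hA=\mathbf h\}$ acts on $\mathcal S$ by $A[\mathbf z]=[A\mathbf z]$. Curves. A lift of a smooth curve $\gamma:\mathbb R\to\mathcal S$ is a smooth $\Gamma:\mathbb R\to\mathcal N$ with $\gamma=[\Gamma]$. $\gamma$ is transversal if $\zeta(\gamma')\neq0$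 everywhere; transversal curves are positively parametrized, $-i\langle\Gamma,\Gamma'\rangle>0$. It is generic if $\det(\Gamma,\Gamma',\Gamma'')$ never vanishes. A Wilczynski lift has $\det(\Gamma,\Gamma',\Gamma'')=-1$; the parametrization is natural if moreover $i\langle\Gamma,\Gamma'\rangle^{-1}=1$, and then bending and twist are $\kappa=\frac12\langle\Gamma',\Gamma'\rangle$, $\tau=\mathrm{Im}\langle\Gamma'',\Gamma'\rangle+3\kappa^2$. A generic transversal curve is isoparametric if $\kappa,\tau$ are constant; an isoparametric string is a closed (periodic) isoparametric curve; it is an isoparametric knot if it is injective on $[0,\omega)$, $\omega$ being its minimal period. Let $\mathrm H_{\kappa,\tau}=i\begin{pmatrix}i\kappa&-i&\tau\\0&-2i\kappa&1\\1&0&i\kappa\end{pmatrix}$ and $D_{\kappa,\tau}=-27+108\kappa(\kappa^2+\tau)-324\kappa^4\tau-72\kappa^2\tau^2-4\tau^3$ (discriminant of its characteristic polynomial). For isoparametric strings $D_{\kappa,\tau}>0$, $\mathrm H_{\kappa,\tau}$ has real eigenvalues $e_1<e_2<e_3$ with sum $0$, and the spectral ratio is $e_1/e_3\in(-2,-1/2)\cap\mathbb Q$. The string is of the first class if $3\kappa>|\tau|^{1/2}$, of the second class if $3\kappa<|\tau|^{1/2}$. Symmetrical configurations of the second kind. For $(r,\rho)\in(-2,-\frac12)\times(0,\sqrt2)$ let $$\mu_2(r,\rho)=\frac{-4+4r-12\rho^2(1+r)+(r-1)\rho^4}{-4+4r-12\rho^2(1+r)+(r-1)\rho^4-2\big((2+3r-3r^2-2r^3)(-4\rho+\rho^5)\big)^{2/3}}\in(0,1),$$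 $e_2^1=r\frac{\mu_2}{1-\mu_2}$, $e_2^2=-(1+r)\frac{\mu_2}{1-\mu_2}$, $e_2^3=\frac{\mu_2}{1-\mu_2}$, $D_2(r,\rho)=\mathrm{diag}(-ie_2^3,-ie_2^2,-ie_2^1)$, $\mathcal U=\begin{pmatrix}\frac1{\sqrt2}&0&\frac i{\sqrt2}\\0&1&0\\\frac i{\sqrt2}&0&\frac1{\sqrt2}\end{pmatrix}$, $S(\rho)=[{}^t(1,\rho,i\rho^2/2)]\in\mathcal S$. For $r\in\mathbb Q$, the symmetrical configuration of the second kind with parameters $(r,\rho)$ is $\eta_{r,\rho}(s)=\big(\mathcal U\exp(sD_2(r,\rho))\,\mathcal U^{-1}\big)S(\rho)$. Cyclides and torus knots. For $\theta_1,\theta_2\in\mathbb R$ let $$R(\theta_1,\theta_2)=\begin{pmatrix}e^{-\frac i6(\theta_1+2\theta_2)}\cos\frac{\theta_1}2&0&e^{-\frac i6(\theta_1+2\theta_2)}\sin\frac{\theta_1}2\\0&e^{\frac i3(\theta_1+2\theta_2)}&0\\-e^{-\frac i6(\theta_1+2\theta_2)}\sin\frac{\theta_1}2&0&e^{-\frac i6(\theta_1+2\theta_2)}\cos\frac{\theta_1}2\end{pmatrix}\in G.$$ These form a torus $\mathrm T^2\subset G$; for $\rho\in(0,\sqrt2)$ the standard Heisenberg cyclide $\mathcal T_\rho$ is the $\mathrm T^2$-orbit of $S(\rho)$, an embedded 2-torus parametrized by $(\theta_1,\theta_2)\in(\mathbb R/2\pi\mathbb Z)^2$ via $R(\theta_1,\theta_2)S(\rho)$.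 Under the Heisenberg projection $[\mathbf z]\mapsto(\mathrm{Re}(z_2/z_1),\mathrm{Im}(z_2/z_1),\mathrm{Re}(z_3/z_1))$ from $\mathcal S\setminus\{[{}^t(0,0,1)]\}$ onto $\mathbb R^3$, $R(0,\theta_2)$ is the counterclockwise rotation by $\theta_2$ about the $z$-axis and $R(\theta_1,0)$ rotates around the Clifford circle $x^2+y^2=2,\ z=0$. A simple closed curve on $\mathcal T_\rho$ along which $\theta_1,\theta_2$ are linear in the parameter is a torus knot of type $(p,q)$, $p,q$ coprime, if $p/q=-\theta_2'/\theta_1'$ (it winds $|p|$ times around the $z$-axis and $|q|$ times around the Clifford circle); it is positive if $pq>0$ and negative if $pq<0$. *)

theory Defs
  imports "HOL-Analysis.Analysis"
begin

subsection \<open>The space \<open>\<complex>\<^sup>2\<^sup>,\<^sup>1\<close> and its null lines\<close>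

definition mat3 :: "'a::zero \<Rightarrow> 'a \<Rightarrow> 'a \<Rightarrow> 'a \<Rightarrow> 'a \<Rightarrow> 'a \<Rightarrow> 'a \<Rightarrow> 'a \<Rightarrow> 'a \<Rightarrow> 'a^3^3" where
  "mat3 a b c d e f g h k = vector [vector [a, b, c], vector [d, e, f], vector [g, h, k]]"

definition herm_mat :: "complex^3^3" where
  "herm_mat = mat3 0 0 \<i>
                   0 1 0
                   (- \<i>) 0 0"

text \<open>Conjugate linear in the first argument.\<close>

definition herm :: "complex^3 \<Rightarrow> complex^3 \<Rightarrow> complex" where
  "herm z w = (\<Sum>i\<in>UNIV. cnj (z $ i) * (herm_mat *v w) $ i)"

definition null_vectors :: "(complex^3) set" where
  "null_vectors = {z. z \<noteq> 0 \<and> herm z z = 0}"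

text \<open>A point \<open>[z]\<close> of the complex projective plane is the complex line spanned by \<open>z \<noteq> 0\<close>,
  regarded as a set of vectors; a matrix \<open>A\<close> acts on such points by \<open>A[z] = [Az]\<close>.\<close>

type_synonym point = "(complex^3) set"

definition proj :: "complex^3 \<Rightarrow> point" where
  "proj z = vec.span {z}"

definition act :: "complex^3^3 \<Rightarrow> point \<Rightarrow> point" where
  "act A L = (\<lambda>z. A *v z) ` L"


subsection \<open>Curves\<close>

definition vderiv :: "(real \<Rightarrow> 'a::real_normed_vector) \<Rightarrow> real \<Rightarrow> 'a" where
  "vderiv f = (\<lambda>t. vector_derivative f (at t))"

definition smooth :: "(real \<Rightarrow> 'a::real_normed_vector) \<Rightarrow> bool" where
  "smooth f \<longleftrightarrow> (\<forall>n t. (vderiv ^^ n) f differentiable (at t))"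

text \<open>The smooth curves in the sphere \<open>\<S>\<close> of null lines are exactly the maps that possess a lift:
  the pullback of the bundle of nonzero null vectors over \<open>\<S>\<close> to the real line is trivial.\<close>

definition lift :: "(real \<Rightarrow> complex^3) \<Rightarrow> (real \<Rightarrow> point) \<Rightarrow> bool" where
  "lift \<Gamma> \<gamma> \<longleftrightarrow> smooth \<Gamma> \<and> (\<forall>t. \<Gamma> t \<in> null_vectors \<and> \<gamma> t = proj (\<Gamma> t))"

text \<open>The contact form on the tangent vector of \<open>\<S>\<close> at \<open>[z]\<close> that is represented by \<open>v\<close>.\<close>

definition contact_form :: "complex^3 \<Rightarrow> complex^3 \<Rightarrow> complex" where
  "contact_form z v = - \<i> * herm z v / (\<Sum>i\<in>UNIV. cnj (z $ i) * z $ i)"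

text \<open>The properties below do not depend on the lift: replacing \<open>\<Gamma>\<close> by \<open>f\<Gamma>\<close> leaves the contact form
  of the velocity unchanged, and multiplies \<open>\<langle>\<Gamma>, \<Gamma>'\<rangle>\<close> by \<open>|f|\<^sup>2\<close>
  and the determinant by \<open>f\<^sup>3\<close>.\<close>

definition transversal :: "(real \<Rightarrow> point) \<Rightarrow> bool" where
  "transversal \<gamma> \<longleftrightarrow> (\<exists>\<Gamma>. lift \<Gamma> \<gamma> \<and> (\<forall>t. contact_form (\<Gamma> t) (vderiv \<Gamma> t) \<noteq> 0))"

text \<open>\<open>-\<i>\<langle>\<Gamma>, \<Gamma>'\<rangle>\<close> is real, since \<open>\<langle>\<Gamma>, \<Gamma>\<rangle>\<close> vanishes identically.\<close>

definition positively_parametrized :: "(real \<Rightarrow> point) \<Rightarrow> bool" where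
  "positively_parametrized \<gamma> \<longleftrightarrow>
     (\<exists>\<Gamma>. lift \<Gamma> \<gamma> \<and> (\<forall>t. Re (- \<i> * herm (\<Gamma> t) (vderiv \<Gamma> t)) > 0))"

definition frame_det :: "(real \<Rightarrow> complex^3) \<Rightarrow> real \<Rightarrow> complex" where
  "frame_det \<Gamma> t = det (transpose (vector [\<Gamma> t, vderiv \<Gamma> t, vderiv (vderiv \<Gamma>) t] :: complex^3^3))"

definition generic :: "(real \<Rightarrow> point) \<Rightarrow> bool" where
  "generic \<gamma> \<longleftrightarrow> (\<exists>\<Gamma>. lift \<Gamma> \<gamma> \<and> (\<forall>t. frame_det \<Gamma> t \<noteq> 0))"

definition wilczynski_lift :: "(real \<Rightarrow> complex^3) \<Rightarrow> (real \<Rightarrow> point) \<Rightarrow> bool" where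
  "wilczynski_lift \<Gamma> \<gamma> \<longleftrightarrow> lift \<Gamma> \<gamma> \<and> (\<forall>t. frame_det \<Gamma> t = -1)"

definition natural_lift :: "(real \<Rightarrow> complex^3) \<Rightarrow> (real \<Rightarrow> point) \<Rightarrow> bool" where
  "natural_lift \<Gamma> \<gamma> \<longleftrightarrow>
     wilczynski_lift \<Gamma> \<gamma> \<and> (\<forall>t. \<i> * inverse (herm (\<Gamma> t) (vderiv \<Gamma> t)) = 1)"

text \<open>Wilczynski lifts differ by a constant cube root of unity, so bending and twist depend
  on the curve only. The form takes real values on the diagonal.\<close>

definition bending :: "(real \<Rightarrow> complex^3) \<Rightarrow> real \<Rightarrow> real" where
  "bending \<Gamma> t = Re (herm (vderiv \<Gamma> t) (vderiv \<Gamma> t)) / 2"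

definition twist :: "(real \<Rightarrow> complex^3) \<Rightarrow> real \<Rightarrow> real" where
  "twist \<Gamma> t = Im (herm (vderiv (vderiv \<Gamma>) t) (vderiv \<Gamma> t)) + 3 * (bending \<Gamma> t)\<^sup>2"

text \<open>Bending and twist refer to the natural parameter, so an isoparametric curve is
  understood to be naturally parametrized.\<close>

definition isoparametric_with :: "real \<Rightarrow> real \<Rightarrow> (real \<Rightarrow> point) \<Rightarrow> bool" where
  "isoparametric_with \<kappa> \<tau> \<gamma> \<longleftrightarrow>
     generic \<gamma> \<and> transversal \<gamma> \<and> positively_parametrized \<gamma> \<and>
     (\<exists>\<Gamma>. natural_lift \<Gamma> \<gamma> \<and> (\<forall>t. bending \<Gamma> t = \<kappa> \<and> twist \<Gamma> t = \<tau>))"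

definition period :: "(real \<Rightarrow> 'a) \<Rightarrow> real \<Rightarrow> bool" where
  "period c \<omega> \<longleftrightarrow> \<omega> > 0 \<and> (\<forall>t. c (t + \<omega>) = c t)"

definition minimal_period :: "(real \<Rightarrow> 'a) \<Rightarrow> real \<Rightarrow> bool" where
  "minimal_period c \<omega> \<longleftrightarrow> period c \<omega> \<and> (\<forall>\<omega>'. period c \<omega>' \<longrightarrow> \<omega> \<le> \<omega>')"

definition simple_closed :: "(real \<Rightarrow> 'a) \<Rightarrow> bool" where
  "simple_closed c \<longleftrightarrow> (\<exists>\<omega>. minimal_period c \<omega> \<and> inj_on c {0..<\<omega>})"

definition isoparametric_string :: "(real \<Rightarrow> point) \<Rightarrow> bool" where
  "isoparametric_string \<gamma> \<longleftrightarrow> (\<exists>\<kappa> \<tau>. isoparametric_with \<kappa> \<tau> \<gamma>) \<and> (\<exists>\<omega>. period \<gamma> \<omega>)"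

definition isoparametric_knot :: "(real \<Rightarrow> point) \<Rightarrow> bool" where
  "isoparametric_knot \<gamma> \<longleftrightarrow> isoparametric_string \<gamma> \<and> simple_closed \<gamma>"

definition H_mat :: "real \<Rightarrow> real \<Rightarrow> complex^3^3" where
  "H_mat \<kappa> \<tau> = (\<chi> i j. \<i> *
     (mat3 (\<i> * \<kappa>) (- \<i>) \<tau>
           0 (- 2 * \<i> * \<kappa>) 1
           1 0 (\<i> * \<kappa>)) $ i $ j)"

definition eigenvalues :: "complex^3^3 \<Rightarrow> complex set" where
  "eigenvalues A = {e. \<exists>v. v \<noteq> 0 \<and> A *v v = e *s v}"

definition has_spectral_ratio :: "(real \<Rightarrow> point) \<Rightarrow> real \<Rightarrow> bool" where
  "has_spectral_ratio \<gamma> r \<longleftrightarrow> isoparametric_string \<gamma> \<and>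
     (\<exists>\<kappa> \<tau> e1 e2 e3 :: real. isoparametric_with \<kappa> \<tau> \<gamma> \<and>
        eigenvalues (H_mat \<kappa> \<tau>) = complex_of_real ` {e1, e2, e3} \<and>
        e1 < e2 \<and> e2 < e3 \<and> r = e1 / e3)"

definition second_class :: "(real \<Rightarrow> point) \<Rightarrow> bool" where
  "second_class \<gamma> \<longleftrightarrow> isoparametric_string \<gamma> \<and>
     (\<exists>\<kappa> \<tau>. isoparametric_with \<kappa> \<tau> \<gamma> \<and> 3 * \<kappa> < sqrt \<bar>\<tau>\<bar>)"


subsection \<open>Symmetrical configurations of the second kind\<close>

definition mat_exp :: "complex^3^3 \<Rightarrow> complex^3^3" where
  "mat_exp A = (\<Sum>n. (1 / fact n :: real) *\<^sub>R (((**) A) ^^ n) (mat 1))"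

text \<open>The base of the fractional power is positive for \<open>-2 < r < -1/2\<close> and \<open>0 < \<rho> < sqrt 2\<close>,
  as \<open>2 + 3r - 3r\<^sup>2 - 2r\<^sup>3 = (1 - r)(2 + r)(1 + 2r)\<close>.\<close>

definition mu2 :: "real \<Rightarrow> real \<Rightarrow> real" where
  "mu2 r \<rho> =
     (- 4 + 4 * r - 12 * \<rho>^2 * (1 + r) + (r - 1) * \<rho>^4) /
     (- 4 + 4 * r - 12 * \<rho>^2 * (1 + r) + (r - 1) * \<rho>^4
        - 2 * ((2 + 3 * r - 3 * r^2 - 2 * r^3) * (- 4 * \<rho> + \<rho>^5)) powr (2 / 3))"

definition D2 :: "real \<Rightarrow> real \<Rightarrow> complex^3^3" where
  "D2 r \<rho> =
     (let m = mu2 r \<rho> / (1 - mu2 r \<rho>); e1 = r * m; e2 = - (1 + r) * m; e3 = m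
      in mat3 (- \<i> * e3) 0 0
              0 (- \<i> * e2) 0
              0 0 (- \<i> * e1))"

definition U_mat :: "complex^3^3" where
  "U_mat = mat3 (1 / sqrt 2) 0 (\<i> / sqrt 2)
                0 1 0
                (\<i> / sqrt 2) 0 (1 / sqrt 2)"

definition base_point :: "real \<Rightarrow> point" where
  "base_point \<rho> = proj (vector [1, complex_of_real \<rho>, \<i> * \<rho>^2 / 2])"

definition eta :: "real \<Rightarrow> real \<Rightarrow> real \<Rightarrow> point" where
  "eta r \<rho> s = act (U_mat ** mat_exp (s *\<^sub>R D2 r \<rho>) ** matrix_inv U_mat) (base_point \<rho>)"


subsection \<open>Heisenberg cyclides and torus knots\<close>

definition R_mat :: "real \<Rightarrow> real \<Rightarrow> complex^3^3" where
  "R_mat \<theta>1 \<theta>2 =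
     (let a = exp (- (\<i> / 6) * (\<theta>1 + 2 * \<theta>2)); b = exp ((\<i> / 3) * (\<theta>1 + 2 * \<theta>2))
      in mat3 (a * cos (\<theta>1 / 2)) 0 (a * sin (\<theta>1 / 2))
              0 b 0
              (- a * sin (\<theta>1 / 2)) 0 (a * cos (\<theta>1 / 2)))"

definition cyclide :: "real \<Rightarrow> point set" where
  "cyclide \<rho> = {act (R_mat \<theta>1 \<theta>2) (base_point \<rho>) | \<theta>1 \<theta>2. True}"

text \<open>\<open>K\<close> is the trajectory of a simple closed curve on the cyclide with linear angles, of slope
  \<open>p/q = - \<theta>\<^sub>2' / \<theta>\<^sub>1'\<close>. The nonvanishing conditions keep both
  quotients meaningful.\<close>

definition torus_knot :: "real \<Rightarrow> int \<Rightarrow> int \<Rightarrow> point set \<Rightarrow> bool" where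
  "torus_knot \<rho> p q K \<longleftrightarrow> coprime p q \<and> q \<noteq> 0 \<and>
     (\<exists>c a1 b1 a2 b2. simple_closed c \<and> K = range c \<and>
        (\<forall>t. c t = act (R_mat (a1 * t + b1) (a2 * t + b2)) (base_point \<rho>)) \<and>
        a1 \<noteq> 0 \<and> real_of_int p / real_of_int q = - a2 / a1)"

definition positive_torus_knot :: "real \<Rightarrow> int \<Rightarrow> int \<Rightarrow> point set \<Rightarrow> bool" where
  "positive_torus_knot \<rho> p q K \<longleftrightarrow> torus_knot \<rho> p q K \<and> p * q > 0"

end

theory Submission
  imports Defs
begin

text \<open>In the basis given by the columns of \<open>\<U>\<close>, which simultaneously diagonalizes the torus and the
  generator of \<open>\<eta>\<close>, the form becomes \<open>diag(-1, 1, 1)\<close>, and a lift of \<open>\<eta>\<close> has components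
  \<open>f\<^sub>j exp(-\<i> e\<^sub>j s)\<close>. All invariants are then moments \<open>\<Sum> w\<^sub>j e\<^sub>j\<^sup>k\<close> of the weights
  \<open>w = (-|f\<^sub>1|\<^sup>2, |f\<^sub>2|\<^sup>2, |f\<^sub>3|\<^sup>2)\<close>, and the determinant is a Vandermonde determinant times
  \<open>f\<^sub>1f\<^sub>2f\<^sub>3\<close>; the value of \<open>\<mu>\<^sub>2\<close> is the one for which a single rescaling of the lift
  normalizes both. Two parameters give the same point iff the three phases agree, so
  everything about closing up reduces to the two frequencies \<open>m(2 + r)\<close> and \<open>m(1 - r)\<close>, which are
  coprime integer multiples of one number.\<close>

section \<open>Matrices, projective points and the Hermitian form\<close>

lemma mat3_nth [simp]:
  "mat3 a b c d e f g h k $ 1 = vector [a, b, c]"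
  "mat3 a b c d e f g h k $ 2 = vector [d, e, f]"
  "mat3 a b c d e f g h k $ 3 = vector [g, h, k]"
  by (simp_all add: mat3_def)

lemma mat3_mult_vec:
  "mat3 a b c d e f g h k *v v = vector [a * v$1 + b * v$2 + c * v$3,
     d * v$1 + e * v$2 + f * v$3, g * v$1 + h * v$2 + k * v$3]"
  by (simp add: vec_eq_iff forall_3 matrix_vector_mult_def sum_3)

lemma mat3_mult:
  "mat3 a b c d e f g h k ** mat3 a' b' c' d' e' f' g' h' k' =
     mat3 (a*a' + b*d' + c*g') (a*b' + b*e' + c*h') (a*c' + b*f' + c*k')
          (d*a' + e*d' + f*g') (d*b' + e*e' + f*h') (d*c' + e*f' + f*k')
          (g*a' + h*d' + k*g') (g*b' + h*e' + k*h') (g*c' + h*f' + k*k')"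
  by (simp add: vec_eq_iff forall_3 matrix_matrix_mult_def sum_3)

lemma mat_1_mat3: "mat 1 = mat3 1 0 0 0 1 0 0 0 1"
  by (simp add: vec_eq_iff forall_3 mat_def)

lemma mat_exp_diag:
  "mat_exp (mat3 a 0 0 0 b 0 0 0 c) = mat3 (exp a) 0 0 0 (exp b) 0 0 0 (exp c)"
proof -
  have pow: "(((**) (mat3 a 0 0 0 b 0 0 0 c)) ^^ n) (mat 1) = mat3 (a^n) 0 0 0 (b^n) 0 0 0 (c^n)" for n
    by (induction n) (simp_all add: mat_1_mat3 mat3_mult)
  have exp: "(\<lambda>n. (1 / fact n :: real) *\<^sub>R z ^ n) sums exp z" for z :: complex
    using exp_converges[of z] by (simp add: inverse_eq_divide)
  have "(\<lambda>n. ((1 / fact n :: real) *\<^sub>R mat3 (a^n) 0 0 0 (b^n) 0 0 0 (c^n)) $ i $ j) sums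
      (mat3 (exp a) 0 0 0 (exp b) 0 0 0 (exp c) $ i $ j)" for i j
    using exp exhaust_3[of i] exhaust_3[of j] by fastforce
  then have "(\<lambda>n. (1 / fact n :: real) *\<^sub>R mat3 (a^n) 0 0 0 (b^n) 0 0 0 (c^n)) sums
      mat3 (exp a) 0 0 0 (exp b) 0 0 0 (exp c)"
    unfolding sums_def by (intro vec_tendstoI) simp
  then show ?thesis
    unfolding mat_exp_def pow by (rule sums_unique[symmetric])
qed

lemma act_proj: "act A (proj v) = proj (A *v v)"
  by (auto simp: act_def proj_def vec.span_singleton image_iff vec.scale)

lemma proj_scale: "c \<noteq> 0 \<Longrightarrow> proj (c *s v) = proj v"
  unfolding proj_def by (rule vec.span_eq[THEN iffD2])
    (auto simp: vec.span_singleton image_iff vector_smult_assoc intro: exI[of _ "inverse c"])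

lemma proj_eq_iff:
  assumes "v \<noteq> 0"
  shows "proj v = proj w \<longleftrightarrow> (\<exists>c. c \<noteq> 0 \<and> v = c *s w)"
proof
  assume "proj v = proj w"
  then have "v \<in> proj w"
    using vec.span_base[of v "{v}"] by (simp add: proj_def)
  then show "\<exists>c. c \<noteq> 0 \<and> v = c *s w"
    using assms by (fastforce simp: proj_def vec.span_singleton)
qed (use proj_scale in auto)

lemma herm_expand: "herm z w = \<i> * cnj (z$1) * w$3 + cnj (z$2) * w$2 - \<i> * cnj (z$3) * w$1"
  by (simp add: herm_def herm_mat_def sum_3 mat3_mult_vec)

subsection \<open>One-parameter orbits in the eigenbasis\<close>

text \<open>The conjugate transpose of the unitary \<open>U_mat\<close>, hence its inverse. A closed
  form is needed because \<open>matrix_inv\<close> is given by choice.\<close>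

definition V_mat :: "complex^3^3" where
  "V_mat = mat3 (1 / sqrt 2) 0 (- \<i> / sqrt 2)
                0 1 0
                (- \<i> / sqrt 2) 0 (1 / sqrt 2)"

lemma of_real_sqrt2: "complex_of_real (sqrt 2) * complex_of_real (sqrt 2) = 2"
  by (metis of_real_mult of_real_numeral real_sqrt_mult_self abs_numeral)

lemma UV: "U_mat ** V_mat = mat 1" and VU: "V_mat ** U_mat = mat 1"
  using of_real_sqrt2 by (simp_all add: U_mat_def V_mat_def mat3_mult mat_1_mat3 field_simps)

lemma matrix_inv_U: "matrix_inv U_mat = V_mat"
proof -
  have "U_mat ** matrix_inv U_mat = mat 1 \<and> matrix_inv U_mat ** U_mat = mat 1"
    unfolding matrix_inv_def by (rule someI[of _ V_mat]) (simp add: UV VU)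
  then show ?thesis
    by (metis VU matrix_mul_assoc matrix_mul_lid matrix_mul_rid)
qed

lemma U_inj: "U_mat *v a = U_mat *v b \<longleftrightarrow> a = b"
  by (metis VU matrix_vector_mul_assoc matrix_vector_mul_lid)

text \<open>The columns of \<open>U_mat\<close> are orthonormal eigenvectors of
  \<open>herm_mat\<close> for the eigenvalues -1, 1, 1.\<close>

lemma herm_U: "herm (U_mat *v z) (U_mat *v w) = - cnj (z$1) * w$1 + cnj (z$2) * w$2 + cnj (z$3) * w$3"
  using of_real_sqrt2 by (simp add: herm_expand U_mat_def mat3_mult_vec field_simps)

lemma det_U: "det U_mat = 1"
  using of_real_sqrt2 by (simp add: det_3 U_mat_def field_simps)

lemma has_vector_derivative_vec:
  fixes f :: "real \<Rightarrow> 'a::euclidean_space ^ 'n"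
  assumes "\<And>i. ((\<lambda>x. f x $ i) has_vector_derivative f' $ i) (at x)"
  shows "(f has_vector_derivative f') (at x)"
  unfolding has_vector_derivative_def
proof (subst has_derivative_componentwise_within, intro ballI)
  fix b :: "'a ^ 'n"
  assume "b \<in> Basis"
  then obtain i u where b: "b = axis i u"
    by (auto simp: Basis_vec_def)
  show "((\<lambda>x. f x \<bullet> b) has_derivative (\<lambda>x. x *\<^sub>R f' \<bullet> b)) (at x)"
    unfolding b inner_axis
    using bounded_linear.has_derivative[OF bounded_linear_inner_left
        assms[of i, unfolded has_vector_derivative_def], of u]
    by simp
qed

text \<open>The coefficients \<open>f\<close> are left free because differentiation only multiplies
  \<open>f$j\<close> by \<open>-\<i> * e$j\<close>: all derivatives of an orbit are orbits with the
  same frequencies.\<close>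

definition osc :: "real^3 \<Rightarrow> complex^3 \<Rightarrow> real \<Rightarrow> complex^3" where
  "osc e f s = U_mat *v (\<chi> j. exp (- \<i> * e$j * s) * f$j)"

lemma osc_has_vector_derivative:
  "(osc e f has_vector_derivative osc e (\<chi> j. - \<i> * e$j * f$j) s) (at s)"
proof (rule has_vector_derivative_vec)
  fix i
  \<comment> \<open>Each component extends to an entire function; its complex derivative is computed
    and restricted to the real line.\<close>
  have "((\<lambda>z. \<Sum>j\<in>UNIV. U_mat$i$j * (exp (- \<i> * e$j * z) * f$j)) has_field_derivative
     (\<Sum>j\<in>UNIV. U_mat$i$j * (exp (- \<i> * e$j * s) * (- \<i> * e$j * f$j)))) (at (of_real s))"
    by (auto intro!: derivative_eq_intros sum.cong)
  then show "((\<lambda>s. osc e f s $ i) has_vector_derivative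
      osc e (\<chi> j. - \<i> * e$j * f$j) s $ i) (at s)"
    by (auto simp: osc_def matrix_vector_mult_def dest!: has_vector_derivative_real_field)
qed

lemma vderiv_osc: "vderiv (osc e f) = osc e (\<chi> j. - \<i> * e$j * f$j)"
  unfolding vderiv_def using osc_has_vector_derivative by (blast intro: vector_derivative_at)

lemma smooth_osc: "smooth (osc e f)"
  unfolding smooth_def
proof (intro allI)
  fix n t
  have "\<exists>g. (vderiv ^^ n) (osc e f) = osc e g"
    by (induction n) (auto simp: vderiv_osc)
  then show "(vderiv ^^ n) (osc e f) differentiable at t"
    using osc_has_vector_derivative differentiableI_vector by metis
qed

lemma exp_phase: "cnj (exp (- \<i> * complex_of_real x * complex_of_real y)) *
    exp (- \<i> * complex_of_real x * complex_of_real y) = 1"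
  by (simp add: exp_cnj flip: exp_add)

text \<open>The form is diagonal in the eigenbasis, so each unimodular phase meets its own conjugate
  and \<open>s\<close> drops out. This is why bending and twist are constant.\<close>

lemma herm_osc: "herm (osc e f s) (osc e g s) = - cnj (f$1) * g$1 + cnj (f$2) * g$2 + cnj (f$3) * g$3"
proof -
  have "cnj (E j * x) * (E j * y) = cnj x * y"
    if "E = (\<lambda>j. exp (- \<i> * complex_of_real (e$j) * complex_of_real s))" for E x y j
  proof -
    have "cnj (E j * x) * (E j * y) = (cnj (E j) * E j) * (cnj x * y)"
      by (simp add: mult_ac)
    then show ?thesis
      by (simp only: that exp_phase mult_1_left)
  qed
  from this[OF refl] show ?thesis
    unfolding osc_def herm_U vec_lambda_beta by (simp only: mult_minus_left)
qed

lemma osc_scale: "osc e (k *s f) s = k *s osc e f s"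
proof -
  have "(\<chi> j. exp (- \<i> * e$j * s) * (k *s f)$j) = k *s (\<chi> j. exp (- \<i> * e$j * s) * f$j)"
    by (simp add: vec_eq_iff)
  then show ?thesis
    by (simp add: osc_def vector_scalar_commute)
qed

lemma transpose_columns:
  "transpose (vector [A *v a, A *v b, A *v c]) = A ** transpose (vector [a, b, c] :: 'a::comm_semiring_1^3^3)"
  by (simp add: vec_eq_iff forall_3 transpose_def matrix_matrix_mult_def matrix_vector_mult_def)

text \<open>Row \<open>j\<close> of the coordinate matrix is \<open>E j * f$j\<close> times
  \<open>1, x, x^2\<close> with \<open>x = -\<i> * e$j\<close>: a Vandermonde determinant, where
  \<open>(-\<i>)^3\<close> gives the leading \<open>\<i>\<close>. The zero sum of the frequencies
  makes the three phases multiply to 1.\<close>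

lemma frame_det_osc:
  assumes "e$1 + e$2 + e$3 = 0"
  shows "frame_det (osc e f) s =
    \<i> * (e$2 - e$1) * (e$3 - e$1) * (e$3 - e$2) * f$1 * f$2 * f$3"
proof -
  define E where "E j = exp (- \<i> * complex_of_real (e$j) * complex_of_real s)" for j
  have "E 1 * E 2 * E 3 = exp (- \<i> * complex_of_real (e$1 + e$2 + e$3) * complex_of_real s)"
    by (simp add: E_def ring_distribs flip: exp_add)
  then have E: "E 1 * E 2 * E 3 = 1"
    by (simp only: assms) simp
  have "frame_det (osc e f) s = det (transpose (vector [\<chi> j. E j * f$j,
      \<chi> j. E j * (- \<i> * e$j * f$j), \<chi> j. E j * (- \<i> * e$j * (- \<i> * e$j * f$j))] :: complex^3^3))"
    unfolding frame_det_def vderiv_osc osc_def transpose_columns det_mul det_U E_def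
    by (simp only: vec_lambda_beta mult_1_left)
  also have "\<dots> = \<i> * (e$2 - e$1) * (e$3 - e$1) * (e$3 - e$2) * f$1 * f$2 * f$3 * (E 1 * E 2 * E 3)"
    by (simp add: det_3 transpose_def) (simp add: algebra_simps)
  finally show ?thesis
    by (simp add: E)
qed

text \<open>Two spanning vectors of one line differ by a factor \<open>c\<close>. As no
  \<open>f$j\<close> vanishes, \<open>c\<close> must equal every relative phase, so it is eliminated
  by comparing the first phase with the other two.\<close>

lemma proj_osc_eq_iff:
  assumes "f$1 \<noteq> 0" "f$2 \<noteq> 0" "f$3 \<noteq> 0"
  shows "proj (osc e f s) = proj (osc e f t) \<longleftrightarrow>
    (\<exists>(k::int) (l::int). (e$1 - e$2) * (s - t) = 2 * pi * k \<and> (e$1 - e$3) * (s - t) = 2 * pi * l)"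
proof -
  have f: "f $ j \<noteq> 0" for j
    using assms exhaust_3[of j] by auto
  have eq: "exp (- \<i> * e$j * s) = c * exp (- \<i> * e$j * t) \<longleftrightarrow> exp (- \<i> * e$j * (s - t)) = c" for j c
    by (auto simp: field_simps exp_diff exp_minus)
  have ph: "exp (- \<i> * complex_of_real a * (s - t)) = exp (- \<i> * complex_of_real b * (s - t)) \<longleftrightarrow>
      (\<exists>k :: int. (a - b) * (s - t) = 2 * pi * k)" for a b
  proof -
    \<comment> \<open>The sides are swapped so that \<open>exp_eq\<close> yields
      \<open>a - b\<close> without a change of sign in \<open>k\<close>.\<close>
    have "exp (- \<i> * complex_of_real a * (s - t)) = exp (- \<i> * complex_of_real b * (s - t)) \<longleftrightarrow>
        exp (- \<i> * complex_of_real b * (s - t)) = exp (- \<i> * complex_of_real a * (s - t))"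
      by auto
    also have "\<dots> \<longleftrightarrow> (\<exists>k :: int. (a - b) * (s - t) = 2 * pi * k)"
      unfolding exp_eq by (simp add: complex_eq_iff algebra_simps)
    finally show ?thesis .
  qed
  have "osc e f s \<noteq> 0"
  proof
    assume "osc e f s = 0"
    then have "(\<chi> j. exp (- \<i> * e$j * s) * f$j) = 0"
      using U_inj[of _ 0] by (simp add: osc_def)
    then show False
      using assms by (simp add: vec_eq_iff forall_3)
  qed
  then have "proj (osc e f s) = proj (osc e f t) \<longleftrightarrow>
      (\<exists>c. c \<noteq> 0 \<and> osc e f s = c *s osc e f t)"
    by (rule proj_eq_iff)
  also have "\<dots> \<longleftrightarrow> (\<exists>c. c \<noteq> 0 \<and> (\<forall>j. exp (- \<i> * e$j * s) = c * exp (- \<i> * e$j * t)))"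
    unfolding osc_scale[symmetric] unfolding osc_def U_inj
    by (simp add: vec_eq_iff f mult.commute)
  also have "\<dots> \<longleftrightarrow> (\<exists>c. c \<noteq> 0 \<and> (\<forall>j. exp (- \<i> * e$j * (s - t)) = c))"
    unfolding eq ..
  also have "\<dots> \<longleftrightarrow> exp (- \<i> * e$1 * (s - t)) = exp (- \<i> * e$2 * (s - t)) \<and>
      exp (- \<i> * e$1 * (s - t)) = exp (- \<i> * e$3 * (s - t))"
    by (auto simp: forall_3)
  also have "\<dots> \<longleftrightarrow> (\<exists>(k::int) (l::int). (e$1 - e$2) * (s - t) = 2 * pi * k \<and>
      (e$1 - e$3) * (s - t) = 2 * pi * l)"
    unfolding ph by blast
  finally show ?thesis .
qed

section \<open>Closing up of curves\<close>

text \<open>The hypothesis makes \<open>c\<close> an injection of the circle of length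
  \<open>2 * pi / g\<close>: a period corresponds to some \<open>k \<ge> 1\<close>, and two
  parameters within one turn to \<open>k = 0\<close>.\<close>

lemma simple_closedI:
  assumes g: "g > 0" and eq: "\<And>s t. c s = c t \<longleftrightarrow> (\<exists>k :: int. g * (s - t) = 2 * pi * k)"
  shows "simple_closed c"
proof -
  have "period c (2 * pi / g)"
    unfolding period_def eq using g by (auto intro!: exI[of _ 1])
  moreover have "2 * pi / g \<le> w" if "period c w" for w
  proof -
    from that obtain k :: int where k: "g * w = 2 * pi * k" "w > 0"
      unfolding period_def eq by fastforce
    then have "2 * pi * k > 0"
      using g by (metis mult_pos_pos)
    then have "k \<ge> 1"
      by (simp add: zero_less_mult_iff)
    then have "2 * pi * 1 \<le> 2 * pi * real_of_int k"
      by (intro mult_left_mono) auto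
    then show ?thesis
      using g k by (simp add: divide_le_eq mult.commute)
  qed
  moreover have "inj_on c {0..<2 * pi / g}"
  proof (rule inj_onI)
    fix x y
    assume x: "x \<in> {0..<2 * pi / g}" and y: "y \<in> {0..<2 * pi / g}" and "c x = c y"
    then obtain k :: int where k: "g * (x - y) = 2 * pi * k"
      using eq by blast
    have "\<bar>x - y\<bar> < 2 * pi / g"
      using x y by auto
    then have "\<bar>g * (x - y)\<bar> < 2 * pi * 1"
      using g unfolding abs_mult by (simp add: field_simps)
    then have "2 * pi * real_of_int \<bar>k\<bar> < 2 * pi * 1"
      unfolding k by (simp add: abs_mult)
    then have "k = 0"
      by simp
    then show "x = y"
      using k g by simp
  qed
  ultimately show ?thesis
    unfolding simple_closed_def minimal_period_def by blast
qed

section \<open>Invariants and spectrum of an orbit\<close>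

text \<open>The last two rows of the eigenvector equation express \<open>v$3\<close> and then
  \<open>v$1\<close> through \<open>v$2\<close>. Hence \<open>v$2\<close> cannot vanish, and the
  first row becomes the polynomial times \<open>v$2\<close>.\<close>

lemma eigenvalues_H_mat:
  fixes \<kappa> \<tau> :: real
  shows "eigenvalues (H_mat \<kappa> \<tau>) =
    {x::complex. (x + \<kappa>)^2 * (x - 2 * \<kappa>) + \<tau> * (x - 2 * \<kappa>) + 1 = 0}"
proof (intro set_eqI iffI)
  have H: "H_mat \<kappa> \<tau> *v v = vector [- \<kappa> * v$1 + v$2 + \<i> * \<tau> * v$3, 2 * \<kappa> * v$2 + \<i> * v$3, \<i> * v$1 - \<kappa> * v$3]"
    for v
    by (simp add: H_mat_def vec_eq_iff forall_3 matrix_vector_mult_def sum_3 algebra_simps)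
  {
    fix x
    assume "x \<in> eigenvalues (H_mat \<kappa> \<tau>)"
    then obtain v where v: "v \<noteq> 0" "H_mat \<kappa> \<tau> *v v = x *s v"
      by (auto simp: eigenvalues_def)
    then have eqs: "- \<kappa> * v$1 + v$2 + \<i> * \<tau> * v$3 = x * v$1" "2 * \<kappa> * v$2 + \<i> * v$3 = x * v$2"
        "\<i> * v$1 - \<kappa> * v$3 = x * v$3"
      unfolding H by (simp_all add: vec_eq_iff forall_3)
    have v3: "v$3 = - \<i> * (x - 2 * \<kappa>) * v$2"
      using arg_cong[OF eqs(2), of "(*) \<i>"] by (simp add: algebra_simps)
    have v1: "v$1 = - \<i> * (x + \<kappa>) * v$3"
      using arg_cong[OF eqs(3), of "(*) (- \<i>)"] by (simp add: algebra_simps)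
    have "v$2 \<noteq> 0"
      using v(1) v1 v3 by (auto simp: vec_eq_iff forall_3)
    moreover have "((x + \<kappa>)^2 * (x - 2 * \<kappa>) + \<tau> * (x - 2 * \<kappa>) + 1) * v$2 = 0"
      using eqs(1) unfolding v1 unfolding v3
      by (simp add: algebra_simps power2_eq_square)
    ultimately show "x \<in> {x::complex. (x + \<kappa>)^2 * (x - 2 * \<kappa>) + \<tau> * (x - 2 * \<kappa>) + 1 = 0}"
      by simp
  }
  {
    fix x :: complex
    assume "x \<in> {x::complex. (x + \<kappa>)^2 * (x - 2 * \<kappa>) + \<tau> * (x - 2 * \<kappa>) + 1 = 0}"
    \<comment> \<open>The witness is the eigenvector found above, normalized by
      \<open>v$2 = 1\<close>.\<close>
    then have "H_mat \<kappa> \<tau> *v vector [- (x + \<kappa>) * (x - 2 * \<kappa>), 1, - \<i> * (x - 2 * \<kappa>)] =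
        x *s vector [- (x + \<kappa>) * (x - 2 * \<kappa>), 1, - \<i> * (x - 2 * \<kappa>)]"
      unfolding H by (simp add: vec_eq_iff forall_3 algebra_simps power2_eq_square)
    then show "x \<in> eigenvalues (H_mat \<kappa> \<tau>)"
      unfolding eigenvalues_def
      by (intro CollectI exI[of _ "vector [- (x + \<kappa>) * (x - 2 * \<kappa>), 1, - \<i> * (x - 2 * \<kappa>)]"] conjI)
        (simp add: vec_eq_iff forall_3)
  }
qed

text \<open>By Lagrange interpolation the moments determine the weights:
  \<open>w\<^sub>j \<Prod>\<^sub>k\<^sub>\<noteq>\<^sub>j (e\<^sub>j - e\<^sub>k) = 2\<kappa> - e\<^sub>j\<close>; the product of these three equations is the claim.
  It identifies the constant term of the characteristic polynomial of \<open>H_mat \<kappa> \<tau>\<close>.\<close>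

lemma cubic_of_moments:
  fixes a b c w1 w2 w3 \<kappa> :: real
  assumes s: "a + b + c = 0"
    and m0: "w1 + w2 + w3 = 0" and m1: "w1 * a + w2 * b + w3 * c = - 1"
    and m2: "w1 * a^2 + w2 * b^2 + w3 * c^2 = 2 * \<kappa>"
    and V: "w1 * w2 * w3 * ((b - a) * (c - a) * (c - b))^2 = - 1"
  shows "(2 * \<kappa> - a) * (2 * \<kappa> - b) * (2 * \<kappa> - c) = 1"
proof -
  have c: "c = - a - b" and w3: "w3 = - w1 - w2"
    using s m0 by linarith+
  have "2 * \<kappa> - a = w1 * ((a - b) * (a - c))" "2 * \<kappa> - b = w2 * ((b - a) * (b - c))"
      "2 * \<kappa> - c = w3 * ((c - a) * (c - b))"
    using m1 m2 unfolding c w3 by algebra+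
  \<comment> \<open>Each difference occurs once with either sign; three sign changes give the
    minus.\<close>
  moreover have *: "w1 * ((a - b) * (a - c)) * (w2 * ((b - a) * (b - c))) * (w3 * ((c - a) * (c - b))) =
      - (w1 * w2 * w3 * ((b - a) * (c - a) * (c - b))^2)"
    by algebra
  ultimately have "(2 * \<kappa> - a) * (2 * \<kappa> - b) * (2 * \<kappa> - c) = - (w1 * w2 * w3 * ((b - a) * (c - a) * (c - b))^2)"
    by (simp only: *)
  then show ?thesis
    by (simp add: V)
qed

text \<open>Products of derivatives are moments of the weights: order 0 is nullity, order 1 the
  natural parameter, order 2 the bending, order 3 the twist. The second claim compares two monic
  cubics.\<close>

lemma osc_isoparametric:
  fixes e :: "real^3" and f :: "complex^3" and w1 w2 w3 \<kappa> :: real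
  defines "\<sigma>2 \<equiv> e$1 * e$2 + e$1 * e$3 + e$2 * e$3"
  assumes w: "cnj (f$1) * f$1 = - complex_of_real w1" "cnj (f$2) * f$2 = complex_of_real w2"
      "cnj (f$3) * f$3 = complex_of_real w3"
    and e: "e$1 + e$2 + e$3 = 0"
    and m0: "w1 + w2 + w3 = 0"
    and m1: "w1 * e$1 + w2 * e$2 + w3 * e$3 = - 1"
    and m2: "w1 * (e$1)^2 + w2 * (e$2)^2 + w3 * (e$3)^2 = 2 * \<kappa>"
    and det: "\<i> * (e$2 - e$1) * (e$3 - e$1) * (e$3 - e$2) * f$1 * f$2 * f$3 = - 1"
  shows "isoparametric_with \<kappa> (\<sigma>2 + 3 * \<kappa>^2) (\<lambda>s. proj (osc e f s))"
    and "eigenvalues (H_mat \<kappa> (\<sigma>2 + 3 * \<kappa>^2)) = complex_of_real ` {e$1, e$2, e$3}"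
proof -
  let ?\<Gamma> = "osc e f"
  have h0: "herm (?\<Gamma> t) (?\<Gamma> t) = 0" for t
    unfolding herm_osc using w m0
    by (simp flip: of_real_add)
  have h1: "herm (?\<Gamma> t) (vderiv ?\<Gamma> t) = \<i>" for t
  proof -
    have "herm (?\<Gamma> t) (vderiv ?\<Gamma> t) = - \<i> * (- (cnj (f$1) * f$1) * e$1 + cnj (f$2) * f$2 * e$2
        + cnj (f$3) * f$3 * e$3)"
      by (simp add: vderiv_osc herm_osc algebra_simps)
    also have "\<dots> = - \<i> * complex_of_real (w1 * e$1 + w2 * e$2 + w3 * e$3)"
      by (simp add: w)
    finally show ?thesis
      by (simp add: m1)
  qed
  have h2: "herm (vderiv ?\<Gamma> t) (vderiv ?\<Gamma> t) = complex_of_real (2 * \<kappa>)" for t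
  proof -
    have "herm (vderiv ?\<Gamma> t) (vderiv ?\<Gamma> t) = - (cnj (f$1) * f$1) * (e$1)^2 + cnj (f$2) * f$2 * (e$2)^2
        + cnj (f$3) * f$3 * (e$3)^2"
      by (simp add: vderiv_osc herm_osc algebra_simps power2_eq_square)
    also have "\<dots> = complex_of_real (w1 * (e$1)^2 + w2 * (e$2)^2 + w3 * (e$3)^2)"
      by (simp add: w)
    finally show ?thesis
      by (simp add: m2)
  qed
  have h3: "herm (vderiv (vderiv ?\<Gamma>) t) (vderiv ?\<Gamma> t) = \<i> * complex_of_real \<sigma>2" for t
  proof -
    \<comment> \<open>Each frequency is a root of a cubic without quadratic term, which reduces the
      third moment to those of orders 1 and 0.\<close>
    have *: "x ^ 3 = - \<sigma>2 * x + e$1 * e$2 * e$3" if "(x - e$1) * (x - e$2) * (x - e$3) = 0" for x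
    proof -
      have "x ^ 3 = (x - e$1) * (x - e$2) * (x - e$3) + (e$1 + e$2 + e$3) * x^2 - \<sigma>2 * x + e$1 * e$2 * e$3"
        unfolding \<sigma>2_def by algebra
      then show ?thesis
        by (simp add: that e)
    qed
    have "herm (vderiv (vderiv ?\<Gamma>) t) (vderiv ?\<Gamma> t) =
        \<i> * (- (cnj (f$1) * f$1) * (e$1)^3 + cnj (f$2) * f$2 * (e$2)^3 + cnj (f$3) * f$3 * (e$3)^3)"
      by (simp add: vderiv_osc herm_osc algebra_simps power3_eq_cube)
    also have "\<dots> = \<i> * complex_of_real (w1 * (e$1)^3 + w2 * (e$2)^3 + w3 * (e$3)^3)"
      by (simp add: w)
    also have "w1 * (e$1)^3 + w2 * (e$2)^3 + w3 * (e$3)^3 =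
        - \<sigma>2 * (w1 * e$1 + w2 * e$2 + w3 * e$3) + e$1 * e$2 * e$3 * (w1 + w2 + w3)"
      by (simp add: *) (simp add: algebra_simps)
    finally show ?thesis
      by (simp add: m0 m1)
  qed
  have fd: "frame_det ?\<Gamma> t = - 1" for t
    by (simp only: frame_det_osc[OF e] det)
  have nz: "?\<Gamma> t \<noteq> 0" for t
    using h1[of t] by (auto simp: herm_expand)
  have lift: "lift ?\<Gamma> (\<lambda>s. proj (osc e f s))"
    unfolding lift_def null_vectors_def using smooth_osc nz h0 by auto
  have nat: "natural_lift ?\<Gamma> (\<lambda>s. proj (osc e f s))"
    unfolding natural_lift_def wilczynski_lift_def using lift fd h1 by simp
  have "(\<Sum>i\<in>UNIV. cnj (?\<Gamma> t $ i) * ?\<Gamma> t $ i) \<noteq> 0" for t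
  proof
    assume "(\<Sum>i\<in>UNIV. cnj (?\<Gamma> t $ i) * ?\<Gamma> t $ i) = 0"
    then have "complex_of_real (\<Sum>i\<in>UNIV. (cmod (?\<Gamma> t $ i))^2) = 0"
      by (simp only: of_real_sum complex_norm_square mult.commute)
    then have "(\<Sum>i\<in>UNIV. (cmod (?\<Gamma> t $ i))^2) = 0"
      by (simp only: of_real_eq_0_iff)
    then show False
      using nz[of t] by (simp add: sum_nonneg_eq_0_iff vec_eq_iff)
  qed
  then have "contact_form (?\<Gamma> t) (vderiv ?\<Gamma> t) \<noteq> 0" for t
    by (simp add: contact_form_def h1)
  moreover have "Re (- \<i> * herm (?\<Gamma> t) (vderiv ?\<Gamma> t)) > 0" for t
    by (simp add: h1)
  moreover have "bending ?\<Gamma> t = \<kappa>" for t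
    by (simp add: bending_def h2)
  moreover from this have "twist ?\<Gamma> t = \<sigma>2 + 3 * \<kappa>^2" for t
    by (simp add: twist_def h3)
  moreover have "frame_det ?\<Gamma> t \<noteq> 0" for t
    by (simp add: fd)
  ultimately show "isoparametric_with \<kappa> (\<sigma>2 + 3 * \<kappa>^2) (\<lambda>s. proj (osc e f s))"
    unfolding isoparametric_with_def generic_def transversal_def positively_parametrized_def
    using lift nat by blast

  define V where "V = (e$2 - e$1) * (e$3 - e$1) * (e$3 - e$2)"
  have "\<i> * complex_of_real V * f$1 * f$2 * f$3 = - 1"
    using det by (simp add: V_def mult_ac)
  \<comment> \<open>Multiplying the normalized determinant by its conjugate replaces each
    \<open>f$j\<close> by its weight; the sign of \<open>w1\<close> then turns 1 into -1.\<close>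
  then have "cnj (\<i> * complex_of_real V * f$1 * f$2 * f$3) * (\<i> * complex_of_real V * f$1 * f$2 * f$3) = 1"
    by simp
  then have "(cnj (f$1) * f$1) * (cnj (f$2) * f$2) * (cnj (f$3) * f$3) * (complex_of_real V)^2 = 1"
    by (simp add: power2_eq_square mult_ac)
  then have "complex_of_real (- (w1 * w2 * w3 * V^2)) = complex_of_real 1"
    unfolding w by simp
  then have "w1 * w2 * w3 * V^2 = - 1"
    unfolding of_real_eq_iff by linarith
  from cubic_of_moments[OF e m0 m1 m2 this[unfolded V_def]]
  have cub: "8 * \<kappa>^3 + 2 * \<kappa> * \<sigma>2 - e$1 * e$2 * e$3 = 1"
    using e unfolding \<sigma>2_def by algebra
  \<comment> \<open>Quadratic coefficients agree by \<open>e\<close>, linear ones by the value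
    \<open>\<sigma>2 + 3 * \<kappa>^2\<close> of the twist, constant ones by
    \<open>cub\<close>.\<close>
  have "(x + \<kappa>)^2 * (x - 2 * \<kappa>) + complex_of_real (\<sigma>2 + 3 * \<kappa>^2) * (x - 2 * \<kappa>) + 1 =
      (x - e$1) * (x - e$2) * (x - e$3)" for x :: complex
  proof -
    have *: "complex_of_real (e$1) + e$2 + e$3 = 0" "8 * complex_of_real \<kappa>^3 + 2 * \<kappa> * \<sigma>2 - e$1 * e$2 * e$3 = 1"
      using arg_cong[OF e, of complex_of_real] arg_cong[OF cub, of complex_of_real] by simp_all
    have **: "complex_of_real \<sigma>2 = e$1 * e$2 + e$1 * e$3 + e$2 * e$3"
      by (simp add: \<sigma>2_def)
    have "(x + \<kappa>)^2 * (x - 2 * \<kappa>) + (complex_of_real \<sigma>2 + 3 * complex_of_real \<kappa>^2) * (x - 2 * \<kappa>) + 1 =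
      (x - e$1) * (x - e$2) * (x - e$3)"
      using * ** unfolding of_real_mult of_real_add of_real_numeral by algebra
    then show ?thesis
      by simp
  qed
  then show "eigenvalues (H_mat \<kappa> (\<sigma>2 + 3 * \<kappa>^2)) = complex_of_real ` {e$1, e$2, e$3}"
    unfolding eigenvalues_H_mat by auto
qed

subsection \<open>The symmetrical configuration as an orbit\<close>

text \<open>Coordinates of the base point in the columns of \<open>U_mat\<close>; none vanishes for
  \<open>0 < \<rho> < sqrt 2\<close>, as \<open>proj_osc_eq_iff\<close> requires.\<close>

definition base_coords :: "real \<Rightarrow> complex^3" where
  "base_coords \<rho> = vector [(2 + \<rho>^2) / (2 * sqrt 2), \<rho>, - \<i> * ((2 - \<rho>^2) / (2 * sqrt 2))]"

lemma U_base_coords: "vector [1, complex_of_real \<rho>, \<i> * \<rho>^2 / 2] = U_mat *v base_coords \<rho>"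
  using of_real_sqrt2
  by (simp add: vec_eq_iff forall_3 base_coords_def U_mat_def mat3_mult_vec field_simps)

text \<open>The inverse of \<open>U_mat\<close> cancels against the \<open>U_mat\<close> of the base
  point, leaving diagonal phases. The frequency \<open>m\<close> comes first because
  \<open>D2\<close> starts with \<open>e3\<close>, so it sits on the negative direction of the
  form.\<close>

lemma eta_osc:
  assumes "m = mu2 r \<rho> / (1 - mu2 r \<rho>)"
  shows "eta r \<rho> s = proj (osc (vector [m, - (1 + r) * m, r * m]) (base_coords \<rho>) s)"
proof -
  have sc: "s *\<^sub>R mat3 (a::complex) 0 0 0 b 0 0 0 c = mat3 (s * a) 0 0 0 (s * b) 0 0 0 (s * c)" for a b c :: complex
    by (simp add: vec_eq_iff forall_3) (simp add: scaleR_conv_of_real)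
  show ?thesis
    unfolding eta_def D2_def Let_def assms[symmetric] sc mat_exp_diag base_point_def act_proj
      U_base_coords matrix_inv_U osc_def
    unfolding matrix_vector_mul_assoc matrix_mul_assoc[symmetric] VU
    unfolding matrix_mul_rid matrix_vector_mul_assoc[symmetric]
    by (rule arg_cong[of _ _ proj], rule arg_cong[of _ _ "(*v) U_mat"])
      (simp add: mat3_mult_vec vec_eq_iff forall_3 mult_ac)
qed

text \<open>The first and third columns of \<open>U_mat\<close> are eigenvectors of the rotation
  block for \<open>exp (\<i> * \<theta>1 / 2)\<close> and its inverse; times the scalar
  \<open>a\<close>, these are the outer phases.\<close>

lemma act_R_mat_base_point:
  "act (R_mat \<theta>1 \<theta>2) (base_point \<rho>) = proj (U_mat *v vector [exp (- \<i> * ((\<theta>2 - \<theta>1) / 3)) * base_coords \<rho> $ 1,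
    exp (\<i> * ((\<theta>1 + 2 * \<theta>2) / 3)) * base_coords \<rho> $ 2, exp (- \<i> * ((2 * \<theta>1 + \<theta>2) / 3)) * base_coords \<rho> $ 3])"
proof -
  define a where "a = exp (- (\<i> / 6) * (\<theta>1 + 2 * \<theta>2))"
  have 1: "exp (- \<i> * ((\<theta>2 - \<theta>1) / 3)) = a * (cos (complex_of_real \<theta>1 / 2) + \<i> * sin (complex_of_real \<theta>1 / 2))"
  proof -
    have "a * exp (\<i> * (complex_of_real \<theta>1 / 2)) = exp (- \<i> * ((\<theta>2 - \<theta>1) / 3))"
      unfolding a_def exp_add[symmetric] by (rule arg_cong[of _ _ exp]) (simp add: field_simps)
    then show ?thesis
      unfolding exp_Euler by simp
  qed
  have 3: "exp (- \<i> * ((2 * \<theta>1 + \<theta>2) / 3)) = a * (cos (complex_of_real \<theta>1 / 2) - \<i> * sin (complex_of_real \<theta>1 / 2))"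
  proof -
    have "a * exp (\<i> * (- (complex_of_real \<theta>1 / 2))) = exp (- \<i> * ((2 * \<theta>1 + \<theta>2) / 3))"
      unfolding a_def exp_add[symmetric] by (rule arg_cong[of _ _ exp]) (simp add: field_simps)
    then show ?thesis
      unfolding exp_Euler by simp
  qed
  have R: "R_mat \<theta>1 \<theta>2 = mat3 (a * cos (complex_of_real \<theta>1 / 2)) 0 (a * sin (complex_of_real \<theta>1 / 2))
      0 (exp (\<i> * ((\<theta>1 + 2 * \<theta>2) / 3))) 0
      (- a * sin (complex_of_real \<theta>1 / 2)) 0 (a * cos (complex_of_real \<theta>1 / 2))"
    by (simp add: R_mat_def Let_def a_def cos_of_real sin_of_real)
  show ?thesis
    unfolding base_point_def act_proj U_base_coords 1 3 R
    by (rule arg_cong[of _ _ proj])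
      (simp add: U_mat_def mat3_mult_vec vec_eq_iff forall_3 field_simps)
qed


text \<open>The angles solve \<open>(\<theta>2 - \<theta>1) / 3 = m * s\<close> and
  \<open>(2 * \<theta>1 + \<theta>2) / 3 = r * m * s\<close>; the middle phase then fits too, since
  the exponents sum to zero on both sides.\<close>

lemma act_R_mat_linear_angles:
  "act (R_mat (- ((1 - r) * m) * s) ((2 + r) * m * s)) (base_point \<rho>) =
    proj (osc (vector [m, - (1 + r) * m, r * m]) (base_coords \<rho>) s)"
  unfolding act_R_mat_base_point osc_def
  by (rule arg_cong[of _ _ proj], rule arg_cong[of _ _ "(*v) U_mat"])
    (auto simp: vec_eq_iff forall_3 field_simps intro!: arg_cong[of _ _ exp])

text \<open>\<open>c\<close> is the scale of the natural lift: the two equations express \<open>\<langle>\<Gamma>, \<Gamma>'\<rangle> = \<i>\<close> and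
  \<open>det(\<Gamma>, \<Gamma>', \<Gamma>'') = -1\<close>.\<close>

lemma mu2_parameters:
  assumes r: "- 2 < r" "r < - 1 / 2" and \<rho>: "0 < \<rho>" "\<rho> < sqrt 2"
  defines "n \<equiv> (1 - r) * (4 + \<rho>^4) + 12 * (1 + r) * \<rho>^2"
  obtains m c where "m > 0" "n > 0" "c > 0" "m = mu2 r \<rho> / (1 - mu2 r \<rho>)" "c^2 * m * n = 8"
    "c^3 * m^3 * \<rho> * (4 - \<rho>^4) * (1 - r) * (2 + r) * (1 + 2 * r) = - 8"
proof -
  have "\<rho>^2 < sqrt 2 ^ 2"
    using \<rho> by (intro power_strict_mono) auto
  then have x: "0 < \<rho>^2" "\<rho>^2 < 2"
    using \<rho> by auto
  then have x2: "(\<rho>^2)^2 < 2^2"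
    by (intro power_strict_mono) auto
  then have x4: "\<rho>^4 < 4"
    by simp
  have n: "n > 0"
  proof -
    \<comment> \<open>As \<open>1 + r\<close> may be negative, positivity is read off after
      completing a square.\<close>
    have "n = (1 - r) * (2 - \<rho>^2)^2 + 8 * (2 + r) * \<rho>^2"
      unfolding n_def by algebra
    moreover have "8 * (2 + r) * \<rho>^2 > 0" "(1 - r) * (2 - \<rho>^2)^2 > 0"
      using x r by (auto intro!: mult_pos_pos)
    ultimately show ?thesis
      by linarith
  qed
  define P where "P = (2 + 3 * r - 3 * r^2 - 2 * r^3) * (- 4 * \<rho> + \<rho>^5)"
  have P_eq: "P = (1 - r) * (2 + r) * (- 1 - 2 * r) * (\<rho> * (4 - \<rho>^4))"
    unfolding P_def by algebra
  have "P > 0"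
    unfolding P_eq using r \<rho> x4 by (intro mult_pos_pos) auto
  \<comment> \<open>The real cube root turns the fractional power into \<open>t^2\<close> and keeps
    its base as \<open>t^3\<close>.\<close>
  define t where "t = P powr (1 / 3)"
  have t: "t > 0" "t^3 = P" "P powr (2 / 3) = t^2"
    using \<open>P > 0\<close> by (simp_all add: t_def powr_powr flip: powr_realpow)
  have mu: "mu2 r \<rho> = n / (n + 2 * t^2)"
  proof -
    have "- 4 + 4 * r - 12 * \<rho>^2 * (1 + r) + (r - 1) * \<rho>^4 = - n"
      unfolding n_def by algebra
    then have "mu2 r \<rho> = (- n) / (- n - 2 * t^2)"
      unfolding mu2_def P_def[symmetric] t(3) by (simp only:)
    also have "- n - 2 * t^2 = - (n + 2 * t^2)"
      by simp
    finally have "mu2 r \<rho> = (- n) / (- (n + 2 * t^2))" .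
    then show ?thesis
      unfolding minus_divide_divide .
  qed
  have "n + 2 * t^2 > 0"
    using n by (simp add: add_pos_nonneg)
  \<comment> \<open>With \<open>m\<close> dictated by \<open>mu\<close>, \<open>c\<close> is the
    positive root of \<open>c^2 * m * n = 8\<close>. Then \<open>c * m * t = 2\<close>, and its cube
    is the determinant equation.\<close>
  define m where "m = n / (2 * t^2)"
  define c where "c = 4 * t / n"
  have pos: "m > 0" "c > 0"
    using n t(1) by (simp_all add: m_def c_def)
  have "1 - mu2 r \<rho> = 2 * t^2 / (n + 2 * t^2)"
    unfolding mu using \<open>n + 2 * t^2 > 0\<close> by (simp add: diff_divide_distrib[symmetric] divide_simps)
  then have m: "m = mu2 r \<rho> / (1 - mu2 r \<rho>)"
    unfolding m_def mu using \<open>n + 2 * t^2 > 0\<close> by simp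
  have cmt: "c * m * t = 2"
    using n t(1) by (simp add: m_def c_def power2_eq_square)
  have "c^3 * m^3 * P = (c * m * t)^3"
    by (simp add: power_mult_distrib t(2))
  then have "c^3 * m^3 * P = 8"
    by (simp add: cmt)
  moreover have "c^3 * m^3 * \<rho> * (4 - \<rho>^4) * (1 - r) * (2 + r) * (1 + 2 * r) = - (c^3 * m^3 * P)"
    unfolding P_eq by algebra
  ultimately have "c^3 * m^3 * \<rho> * (4 - \<rho>^4) * (1 - r) * (2 + r) * (1 + 2 * r) = - 8"
    by simp
  moreover have "c^2 * m * n = 8"
    using n t(1) by (simp add: m_def c_def power2_eq_square)
  ultimately show ?thesis
    using that[OF pos(1) n pos(2) m] by simp
qed

section \<open>The class inequality and the invariants of the configuration\<close>

text \<open>For \<open>\<kappa> \<ge> 0\<close> it suffices that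
  \<open>12 * \<kappa>^2 < m^2 * (1 + r + r^2)\<close>. This follows from
  \<open>\<kappa> < - (m * (1 + r) / 2)\<close>, because \<open>3 * (1 + r)^2\<close> and
  \<open>1 + r + r^2\<close> differ by the negative number
  \<open>(2 + r) * (1 + 2 * r)\<close>.\<close>

lemma second_class_bound:
  fixes r x m n \<kappa> :: real
  assumes r: "- 2 < r" "r < - 1 / 2" and x: "0 < x" and m: "0 < m"
    and n: "0 < n" "n = (1 - r) * (4 + x^2) + 12 * (1 + r) * x"
    and \<kappa>: "2 * \<kappa> * n = m * ((4 + 16 * r + 4 * r^2) * x - (1 - r^2) * (4 + x^2))"
  shows "3 * \<kappa> < sqrt \<bar>3 * \<kappa>^2 - m^2 * (1 + r + r^2)\<bar>"
proof (cases "\<kappa> < 0")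
  case True
  then show ?thesis
    using real_sqrt_ge_zero[of "\<bar>3 * \<kappa>^2 - m^2 * (1 + r + r^2)\<bar>"] by linarith
next
  case False
  \<comment> \<open>Adding \<open>m * (1 + r) * n\<close> cancels the terms in
    \<open>4 + x^2\<close>.\<close>
  have "(2 * \<kappa> + m * (1 + r)) * n = - (m * x * (2 * ((- 2 - 4 * r) * (4 + 2 * r))))"
    using \<kappa> n(2) by algebra
  also have "\<dots> < 0"
    using r x m by (simp add: mult_pos_pos)
  finally have "\<kappa> < - (m * (1 + r) / 2)"
    using n(1) by (simp add: mult_less_0_iff)
  then have "\<kappa>^2 < (- (m * (1 + r) / 2))^2"
    using False by (intro power_strict_mono) auto
  then have "12 * \<kappa>^2 < 3 * (m^2 * (1 + r)^2)"
    by (simp add: power_mult_distrib power_divide)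
  also have "\<dots> = m^2 * (1 + r + r^2) + m^2 * ((2 + r) * (1 + 2 * r))"
    by algebra
  also have "\<dots> < m^2 * (1 + r + r^2)"
    using r m by (simp add: mult_pos_neg)
  finally have "(3 * \<kappa>)^2 < \<bar>3 * \<kappa>^2 - m^2 * (1 + r + r^2)\<bar>"
    by (simp add: power_mult_distrib)
  then show ?thesis
    by (rule real_less_rsqrt)
qed

lemma eta_isoparametric:
  assumes r: "- 2 < r" "r < - 1 / 2" and \<rho>: "0 < \<rho>" "\<rho> < sqrt 2"
  obtains m \<kappa> \<tau> where "m > 0" "isoparametric_with \<kappa> \<tau> (eta r \<rho>)" "3 * \<kappa> < sqrt \<bar>\<tau>\<bar>"
    "eigenvalues (H_mat \<kappa> \<tau>) = complex_of_real ` {r * m, - (1 + r) * m, m}"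
    "\<And>s. eta r \<rho> s = proj (osc (vector [m, - (1 + r) * m, r * m]) (base_coords \<rho>) s)"
proof -
  define n where "n = (1 - r) * (4 + \<rho>^4) + 12 * (1 + r) * \<rho>^2"
  obtain m c where m: "m > 0" "n > 0" "c > 0" "m = mu2 r \<rho> / (1 - mu2 r \<rho>)"
    and c2: "c^2 * m * n = 8"
    and c3: "c^3 * m^3 * \<rho> * (4 - \<rho>^4) * (1 - r) * (2 + r) * (1 + 2 * r) = - 8"
    using mu2_parameters[OF assms] unfolding n_def by metis
  define e :: "real^3" where "e = vector [m, - (1 + r) * m, r * m]"
  define f where "f = complex_of_real c *s base_coords \<rho>"
  define w1 w2 w3 where "w1 = - (c^2 * (2 + \<rho>^2)^2 / 8)" and "w2 = c^2 * \<rho>^2"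
    and "w3 = c^2 * (2 - \<rho>^2)^2 / 8"
  define \<kappa> where "\<kappa> = (w1 * (e$1)^2 + w2 * (e$2)^2 + w3 * (e$3)^2) / 2"
  define \<sigma>2 where "\<sigma>2 = e$1 * e$2 + e$1 * e$3 + e$2 * e$3"
  have e: "e$1 = m" "e$2 = - (1 + r) * m" "e$3 = r * m"
    by (simp_all add: e_def)
  have f: "f$1 = c * (2 + \<rho>^2) / (2 * sqrt 2)" "f$2 = c * \<rho>" "f$3 = - \<i> * (c * (2 - \<rho>^2) / (2 * sqrt 2))"
    by (simp_all add: f_def base_coords_def)
  have eta: "eta r \<rho> s = proj (osc e (base_coords \<rho>) s)" for s
    unfolding e_def by (rule eta_osc[OF m(4)])
  have eta': "eta r \<rho> = (\<lambda>s. proj (osc e f s))"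
    using m(3) by (auto simp: eta f_def osc_scale proj_scale)
  have w: "cnj (f$1) * f$1 = - complex_of_real w1" "cnj (f$2) * f$2 = complex_of_real w2"
      "cnj (f$3) * f$3 = complex_of_real w3"
    using of_real_sqrt2
    by (simp_all add: f w1_def w2_def w3_def power2_eq_square) (simp add: algebra_simps)
  have W: "8 * w1 = - (c^2 * (2 + \<rho>^2)^2)" "w2 = c^2 * \<rho>^2" "8 * w3 = c^2 * (2 - \<rho>^2)^2"
    by (simp_all add: w1_def w2_def w3_def)
  have "8 * (w1 + w2 + w3) = 0"
    using W by algebra
  then have m0: "w1 + w2 + w3 = 0"
    by simp
  \<comment> \<open>This is the origin of \<open>n\<close>: up to the factor \<open>c^2 * m\<close>
    it is minus eight times the first moment.\<close>
  have "8 * (w1 * e$1 + w2 * e$2 + w3 * e$3) = - (c^2 * m * n)"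
    using W unfolding e n_def by algebra
  then have m1: "w1 * e$1 + w2 * e$2 + w3 * e$3 = - 1"
    unfolding c2 by simp
  have m2: "w1 * (e$1)^2 + w2 * (e$2)^2 + w3 * (e$3)^2 = 2 * \<kappa>"
    unfolding \<kappa>_def by simp
  have det: "\<i> * (e$2 - e$1) * (e$3 - e$1) * (e$3 - e$2) * f$1 * f$2 * f$3 = - 1"
  proof -
    have "f$1 * f$3 = - \<i> * (c * (2 + \<rho>^2) * (c * (2 - \<rho>^2)) / (4 * (sqrt 2 * sqrt 2)))"
      unfolding f by (simp only: of_real_mult of_real_divide of_real_numeral) (simp add: mult_ac)
    then have f13: "8 * (f$1 * f$3) = - \<i> * complex_of_real (c^2 * (4 - \<rho>^4))"
      by (simp add: algebra_simps power2_eq_square power4_eq_xxxx)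
    have d: "complex_of_real (e$2) - e$1 = - complex_of_real ((2 + r) * m)"
        "complex_of_real (e$3) - e$1 = - complex_of_real ((1 - r) * m)"
        "complex_of_real (e$3) - e$2 = complex_of_real ((1 + 2 * r) * m)"
      unfolding e by (simp_all add: algebra_simps)
    have "8 * (\<i> * (e$2 - e$1) * (e$3 - e$1) * (e$3 - e$2) * f$1 * f$2 * f$3) =
        \<i> * (complex_of_real (e$2) - e$1) * (complex_of_real (e$3) - e$1) * (complex_of_real (e$3) - e$2)
          * f$2 * (8 * (f$1 * f$3))"
      by (simp add: mult_ac)
    also have "\<dots> = complex_of_real (c^3 * m^3 * \<rho> * (4 - \<rho>^4) * (1 - r) * (2 + r) * (1 + 2 * r))"
      unfolding d f13 f(2) by (simp add: power2_eq_square power3_eq_cube mult_ac)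
    finally show ?thesis
      unfolding c3 by (simp add: mult_ac)
  qed
  have s0: "e$1 + e$2 + e$3 = 0"
    by (simp add: e algebra_simps)
  note iso = osc_isoparametric[OF w s0 m0 m1 m2 det, folded \<sigma>2_def]
  have \<tau>: "\<sigma>2 + 3 * \<kappa>^2 = 3 * \<kappa>^2 - m^2 * (1 + r + r^2)"
    unfolding \<sigma>2_def e by algebra
  \<comment> \<open>Multiplying by \<open>n\<close> produces \<open>c^2 * m * n\<close>, so that
    \<open>c2\<close> eliminates the scale from the bending.\<close>
  have "8 * (2 * \<kappa> * n) = (c^2 * m * n) * (m * ((4 + 16 * r + 4 * r^2) * \<rho>^2 - (1 - r^2) * (4 + (\<rho>^2)^2)))"
    unfolding m2[symmetric] e using W by algebra
  then have "2 * \<kappa> * n = m * ((4 + 16 * r + 4 * r^2) * \<rho>^2 - (1 - r^2) * (4 + (\<rho>^2)^2))"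
    unfolding c2 by simp
  then have "3 * \<kappa> < sqrt \<bar>\<sigma>2 + 3 * \<kappa>^2\<bar>"
    unfolding \<tau> using r \<rho> m by (intro second_class_bound[of r "\<rho>^2" m n]) (auto simp: n_def)
  moreover have "complex_of_real ` {e$1, e$2, e$3} = complex_of_real ` {r * m, - (1 + r) * m, m}"
    unfolding e by auto
  ultimately show ?thesis
    using that[OF m(1), of \<kappa> "\<sigma>2 + 3 * \<kappa>^2"] iso[folded eta'] eta unfolding e_def by simp
qed

section \<open>Arithmetic of the frequencies and conclusion\<close>

text \<open>Bezout writes \<open>y\<close> as an integral combination of \<open>p * y\<close> and
  \<open>q * y\<close>. This merges the two closing conditions of the curve into one.\<close>

lemma coprime_multiples_integral:
  fixes p q k l :: int and y :: real
  assumes "coprime p q" "p * y = k" "q * y = l"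
  shows "\<exists>j :: int. y = j"
proof -
  obtain u v where "u * p + v * q = 1"
    using assms(1) bezout_int[of p q] by auto
  then have "y = (u * p + v * q :: int) * y"
    by simp
  also have "\<dots> = u * (p * y) + v * (q * y)"
    by (simp add: algebra_simps)
  finally show ?thesis
    unfolding assms(2,3) by (metis of_int_add of_int_mult)
qed

theorem proposition4p12:
  fixes r :: rat and \<rho> :: real and p q :: int
  assumes "- 2 < r" "r < - 1 / 2"
    and "0 < \<rho>" "\<rho> < sqrt 2"
    and "quotient_of ((2 + r) / (1 - r)) = (p, q)"
  shows "isoparametric_knot (eta (of_rat r) \<rho>)
    \<and> second_class (eta (of_rat r) \<rho>)
    \<and> has_spectral_ratio (eta (of_rat r) \<rho>) (of_rat r)
    \<and> p > 0 \<and> q > 0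
    \<and> positive_torus_knot \<rho> p q (range (eta (of_rat r) \<rho>))
    \<and> range (eta (of_rat r) \<rho>) \<subseteq> cyclide \<rho>"
proof -
  define R :: real where "R = of_rat r"
  have "of_rat (- 2) < R" "R < of_rat (- 1 / 2)"
    unfolding R_def of_rat_less using assms by auto
  then have R: "- 2 < R" "R < - 1 / 2"
    by (simp_all add: of_rat_divide of_rat_minus)
  obtain m \<kappa> \<tau> where m: "m > 0" and iso: "isoparametric_with \<kappa> \<tau> (eta R \<rho>)"
    and cl: "3 * \<kappa> < sqrt \<bar>\<tau>\<bar>"
    and ev: "eigenvalues (H_mat \<kappa> \<tau>) = complex_of_real ` {R * m, - (1 + R) * m, m}"
    and eta: "\<And>s. eta R \<rho> s = proj (osc (vector [m, - (1 + R) * m, R * m]) (base_coords \<rho>) s)"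
    using eta_isoparametric[OF R assms(3,4)] by metis
  have pq: "(2 + r) / (1 - r) = of_int p / of_int q"
    using assms(5) by (rule quotient_of_div)
  have q: "q > 0" and cop: "coprime p q"
    using assms(5) by (rule quotient_of_denom_pos quotient_of_coprime)+
  have "(2 + r) / (1 - r) > 0"
    using assms by (simp add: zero_less_divide_iff)
  then have p: "p > 0"
    using q unfolding pq by (simp add: zero_less_divide_iff)
  have "(2 + R) / (1 - R) = of_rat ((2 + r) / (1 - r))"
    by (simp add: R_def of_rat_divide of_rat_add of_rat_diff)
  then have ratio: "(2 + R) / (1 - R) = p / q"
    unfolding pq by (simp add: of_rat_divide)
  \<comment> \<open>The common measure of the two frequencies, which are \<open>q\<close> and
    \<open>p\<close> times \<open>g\<close>; \<open>2 * pi / g\<close> becomes the minimal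
    period.\<close>
  define g where "g = m * (1 - R) / q"
  have "2 + R = p / q * (1 - R)"
    using R unfolding ratio[symmetric] by simp
  then have g: "g > 0" "m * (1 - R) = q * g" "m * (2 + R) = p * g"
    using m R q by (simp_all add: g_def)
  have "eta R \<rho> s = eta R \<rho> t \<longleftrightarrow> (\<exists>k :: int. g * (s - t) = 2 * pi * k)" for s t
  proof -
    have "\<rho>^2 < sqrt 2 ^ 2"
      using assms(3,4) by (intro power_strict_mono) auto
    then have nz: "2 - \<rho>^2 \<noteq> 0" "2 + \<rho>^2 \<noteq> 0"
      by (simp_all add: add_pos_nonneg less_imp_neq[symmetric])
    have "base_coords \<rho> $ 1 \<noteq> 0" "base_coords \<rho> $ 2 \<noteq> 0" "base_coords \<rho> $ 3 \<noteq> 0"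
      using assms(3) nz unfolding base_coords_def vector_3
      by (simp_all only: mult_eq_0_iff divide_eq_0_iff of_real_eq_0_iff neg_equal_0_iff_equal) auto
    from proj_osc_eq_iff[OF this]
    have "eta R \<rho> s = eta R \<rho> t \<longleftrightarrow> (\<exists>(k::int) (l::int). (m - - (1 + R) * m) * (s - t) = 2 * pi * k \<and>
        (m - R * m) * (s - t) = 2 * pi * l)"
      unfolding eta by simp
    also have "m - - (1 + R) * m = p * g"
      using g(3) by (simp add: algebra_simps)
    also have "m - R * m = q * g"
      using g(2) by (simp add: algebra_simps)
    also have "(\<exists>(k::int) (l::int). p * g * (s - t) = 2 * pi * k \<and> q * g * (s - t) = 2 * pi * l) \<longleftrightarrow>
        (\<exists>k :: int. g * (s - t) = 2 * pi * k)"
    proof safe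
      fix k l :: int
      assume "p * g * (s - t) = 2 * pi * k" "q * g * (s - t) = 2 * pi * l"
      then have "p * (g * (s - t) / (2 * pi)) = k" "q * (g * (s - t) / (2 * pi)) = l"
        by (simp_all add: field_simps)
      then obtain j :: int where "g * (s - t) / (2 * pi) = j"
        using coprime_multiples_integral[OF cop] by blast
      then show "\<exists>k :: int. g * (s - t) = 2 * pi * k"
        by (intro exI[of _ j]) (simp add: field_simps)
    next
      fix k :: int
      assume "g * (s - t) = 2 * pi * k"
      then show "\<exists>(k::int) (l::int). p * g * (s - t) = 2 * pi * k \<and> q * g * (s - t) = 2 * pi * l"
        by (intro exI[of _ "p * k"] exI[of _ "q * k"]) (simp add: mult_ac)
    qed
    finally show ?thesis .
  qed
  then have simple: "simple_closed (eta R \<rho>)"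
    by (rule simple_closedI[OF g(1)])
  then have "\<exists>\<omega>. period (eta R \<rho>) \<omega>"
    by (auto simp: simple_closed_def minimal_period_def)
  then have string: "isoparametric_string (eta R \<rho>)"
    using iso by (auto simp: isoparametric_string_def)
  have torus: "eta R \<rho> s = act (R_mat (- ((1 - R) * m) * s) ((2 + R) * m * s)) (base_point \<rho>)" for s
    unfolding eta act_R_mat_linear_angles ..
  have "has_spectral_ratio (eta R \<rho>) R"
    unfolding has_spectral_ratio_def
  proof (intro conjI string exI)
    show "eigenvalues (H_mat \<kappa> \<tau>) = complex_of_real ` {R * m, - (1 + R) * m, m}"
      by (rule ev)
    \<comment> \<open>The order of the eigenvalues restates the bounds on \<open>R\<close>:
      \<open>R < - 1 / 2\<close> here, \<open>- 2 < R\<close> below.\<close>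
    show "R * m < - (1 + R) * m"
      using R m by (intro mult_strict_right_mono) auto
    have "- (1 + R) * m < 1 * m"
      using R m by (intro mult_strict_right_mono) auto
    then show "- (1 + R) * m < m"
      by simp
  qed (use iso m in auto)
  moreover have "torus_knot \<rho> p q (range (eta R \<rho>))"
  proof -
    \<comment> \<open>The angles run in opposite directions, so \<open>- a2 / a1\<close> is
      positive; both offsets are 0.\<close>
    have "\<forall>t. eta R \<rho> t = act (R_mat (- ((1 - R) * m) * t + 0) ((2 + R) * m * t + 0)) (base_point \<rho>)"
      using torus by simp
    moreover have "- ((1 - R) * m) \<noteq> 0"
      using R m by simp
    moreover have "real_of_int p / real_of_int q = - ((2 + R) * m) / - ((1 - R) * m)"
      unfolding ratio[symmetric] using R m by simp
    ultimately have "\<exists>c a1 b1 a2 b2. simple_closed c \<and> range (eta R \<rho>) = range c \<and>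
        (\<forall>t. c t = act (R_mat (a1 * t + b1) (a2 * t + b2)) (base_point \<rho>)) \<and>
        a1 \<noteq> 0 \<and> real_of_int p / real_of_int q = - a2 / a1"
      using simple by (intro exI conjI) (assumption | rule refl)+
    then show ?thesis
      using cop q unfolding torus_knot_def by simp
  qed
  moreover have "range (eta R \<rho>) \<subseteq> cyclide \<rho>"
  proof
    fix L
    assume "L \<in> range (eta R \<rho>)"
    then obtain s where "L = eta R \<rho> s"
      by blast
    then show "L \<in> cyclide \<rho>"
      unfolding torus cyclide_def by blast
  qed
  moreover have "second_class (eta R \<rho>)"
    unfolding second_class_def using string iso cl by blast
  ultimately show ?thesis
    using string simple p q unfolding R_def[symmetric] isoparametric_knot_def positive_torus_knot_def
    by simp
qed

end
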